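(* Let $b$ be a natural number and let $c,d\in\mathbb{Z}$ with $c\not\equiv d\pmod b$ and $\gcd(c,b)=\gcd(d,b)=1$. Let $\{c,d\}$ be a suitable set for $b$. Let $t>0$ be an integer such that $t\equiv d-c^*\pmod b$, where $c^*$ is an inverse of $c$ modulo $b$. Put $b_1=bt$, $c_1=1+ct$, $d_1=1+dt$. Then $b_1>b$ and $\{c_1,d_1\}$ is a suitable set for $b_1$.
   Context: For a natural number $b$ (positive integer) and an integer $c$ with $\gcd(c,b)=1$, the classical Dedekind sum is $s(c,b)=\sum_{k=1}^{b}((k/b))((ck/b))$, where $((x))=x-\lfloor x\rfloor-1/2$ if $x\in\mathbb{R}\setminus\mathbb{Z}$ and $((x))=0$ if $x\in\mathbb{Z}$. The normalized Dedekind sum is $S(c,b)=12\,s(c,b)$. For $\gcd(c,b)=1$, $c^*$ denotes an integer with $cc^*\equiv 1\pmod b$ (determined up to multiples of $b$). Definition (suitable set): let $b$ be a natural number and let $c,d\in\mathbb{Z}$ with $c\not\equiv d\pmod b$ and $\gcd(c,b)=\gcd(d,b)=1$ (in particular, $b>1$). The set $\{c,d\}$ is called a suitable set for (the modulus) $b$ if, and only if, $d\not\equiv c^*\pmod b$ and $S(c,b)=S(d,b)\neq 0$. (Thus the assertion that $\{c_1,d_1\}$ is suitable for $b_1$ includes $\gcd(c_1,b_1)=\gcd(d_1,b_1)=1$ and $c_1\not\equiv d_1\pmod{b_1}$, and the inverse of $c_1$ is then taken modulo $b_1$.) *)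

theory Defs
  imports Complex_Main "HOL-Number_Theory.Number_Theory"
begin

definition sawtooth :: "real \<Rightarrow> real" where
  "sawtooth x = (if x \<in> \<int> then 0 else x - of_int \<lfloor>x\<rfloor> - 1 / 2)"

definition dedekind_sum :: "int \<Rightarrow> int \<Rightarrow> real" where
  "dedekind_sum c b =
     (\<Sum>k=1..b. sawtooth (of_int k / of_int b) * sawtooth (of_int (c * k) / of_int b))"

definition norm_dedekind_sum :: "int \<Rightarrow> int \<Rightarrow> real" where
  "norm_dedekind_sum c b = 12 * dedekind_sum c b"

text \<open>
  The set \<open>{c, d}\<close> is suitable for the modulus \<open>b\<close>. The predicate takes the two elements
  as separate arguments; it is symmetric in them (see \<open>suitable_commute\<close>), so it
  depends only on the set. The inverse of \<open>c\<close> modulo \<open>b\<close> is only determined modulo \<open>b\<close>,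
  so the condition on it is stated for every representative; one exists by coprimality.
\<close>
definition suitable :: "int \<Rightarrow> int \<Rightarrow> int \<Rightarrow> bool" where
  "suitable b c d \<longleftrightarrow>
     b > 0 \<and> \<not> [c = d] (mod b) \<and> gcd c b = 1 \<and> gcd d b = 1 \<and>
     (\<forall>cinv. [c * cinv = 1] (mod b) \<longrightarrow> \<not> [d = cinv] (mod b)) \<and>
     norm_dedekind_sum c b = norm_dedekind_sum d b \<and> norm_dedekind_sum d b \<noteq> 0"

lemma suitable_commute: "suitable b c d \<longleftrightarrow> suitable b d c"
proof -
  have *: "(\<forall>xinv. [x * xinv = 1] (mod b) \<longrightarrow> \<not> [y = xinv] (mod b)) \<longleftrightarrow> \<not> [x * y = 1] (mod b)"
    for x y :: int
    by (meson cong_refl cong_scalar_left cong_trans)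
  show ?thesis
    unfolding suitable_def * by (auto simp: cong_sym_eq mult.commute)
qed

end

theory Submission
  imports Defs
begin

text \<open>
  The theorem rests on the three-term relation
  \<open>S(1 + ct, bt) = S(c, b) - S(d, b) + (t\<^sup>2 + 2)/(bt) - 3\<close>, valid when \<open>cd \<equiv> 1 + ct (mod b)\<close>.
  Equality \<open>S(c, b) = S(d, b)\<close> forces \<open>c + c\<^sup>* \<equiv> d + d\<^sup>* (mod b)\<close>, because
  \<open>b S(c, b)\<close> is an integer congruent to \<open>c + c\<^sup>*\<close>; so the hypothesis on \<open>t\<close> is symmetric
  in \<open>c\<close> and \<open>d\<close>, and both normalized sums for \<open>b\<^sub>1\<close> equal \<open>(t\<^sup>2 + 2)/(bt) - 3\<close>,
  which vanishes only for \<open>b = 1\<close>. If \<open>c\<^sub>1 d\<^sub>1 \<equiv> 1 (mod b\<^sub>1)\<close>, then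
  \<open>d\<^sup>2 \<equiv> -1 (mod b)\<close>, which makes \<open>S(d, b)\<close> vanish.
\<close>

section \<open>Residue sums, permutations of residues and power sums\<close>

definition residue_sum :: "int \<Rightarrow> int \<Rightarrow> int" where
  "residue_sum c b = (\<Sum>k\<in>{0..<b}. k * ((c * k) mod b))"

lemma bij_betw_affine_mod:
  fixes b c y :: int
  assumes "b > 0" "gcd c b = 1"
  shows "bij_betw (\<lambda>k. (c * k + y) mod b) {0..<b} {0..<b}"
proof -
  have inj: "inj_on (\<lambda>k. (c * k + y) mod b) {0..<b}"
  proof (rule inj_onI)
    fix k l assume kl: "k \<in> {0..<b}" "l \<in> {0..<b}" and "(c * k + y) mod b = (c * l + y) mod b"
    then have "[c * k + y = c * l + y] (mod b)" by (simp add: cong_def)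
    then have "[c * k = c * l] (mod b)" by (simp only: cong_add_rcancel)
    then have "[k = l] (mod b)"
      using assms(2) by (simp add: cong_mult_lcancel coprime_iff_gcd_eq_1)
    then show "k = l" using kl by (auto simp: cong_def)
  qed
  have "(\<lambda>k. (c * k + y) mod b) ` {0..<b} \<subseteq> {0..<b}" using assms(1) by auto
  then have "(\<lambda>k. (c * k + y) mod b) ` {0..<b} = {0..<b}"
    using inj by (intro endo_inj_surj) auto
  with inj show ?thesis by (simp add: bij_betw_def)
qed

lemma sum_mult_mod:
  fixes b c :: int and g :: "int \<Rightarrow> 'a::comm_monoid_add"
  assumes "b > 0" "gcd c b = 1"
  shows "(\<Sum>k\<in>{0..<b}. g ((c * k) mod b)) = (\<Sum>k\<in>{0..<b}. g k)"
  using sum.reindex_bij_betw[OF bij_betw_affine_mod[OF assms, of 0], of g] by simp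

lemma int_div_less_iff:
  fixes b n t :: int
  assumes "b > 0"
  shows "n div b < t \<longleftrightarrow> n < t * b"
proof -
  have "n div b < t \<longleftrightarrow> \<lfloor>of_int n / of_int b :: real\<rfloor> < t"
    by (simp only: floor_divide_of_int_eq)
  also have "\<dots> \<longleftrightarrow> real_of_int n < of_int (t * b)"
    using assms by (simp add: floor_less_iff divide_less_eq)
  finally show ?thesis by (simp only: of_int_less_iff)
qed

lemma sum_int_lessThan:
  fixes b :: int
  assumes "b \<ge> 0"
  shows "2 * (\<Sum>k\<in>{0..<b}. k) = b * (b - 1)"
  using assms
proof (induction b rule: int_ge_induct)
  case (step i)
  have "{0..<i + 1} = insert i {0..<i}" using step.hyps by auto
  then show ?case using step.IH by (simp add: algebra_simps)
qed simp

lemma sum_int_squares_lessThan: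
  fixes b :: int
  assumes "b \<ge> 0"
  shows "6 * (\<Sum>k\<in>{0..<b}. k\<^sup>2) = (b - 1) * b * (2 * b - 1)"
  using assms
proof (induction b rule: int_ge_induct)
  case (step i)
  have "{0..<i + 1} = insert i {0..<i}" using step.hyps by auto
  then show ?case using step.IH by (simp add: algebra_simps power2_eq_square)
qed simp

section \<open>Integrality, congruence and vanishing of normalized Dedekind sums\<close>

lemma sawtooth_of_int_div:
  assumes "b > 0"
  shows "sawtooth (of_int n / of_int b) =
    (if n mod b = 0 then 0 else of_int (n mod b) / of_int b - 1 / 2)"
proof -
  have "(of_int n / of_int b :: real) \<in> \<int> \<longleftrightarrow> n mod b = 0"
    using assms by (simp add: of_int_div_of_int_in_Ints_iff dvd_eq_mod_eq_0)
  moreover have "(of_int n / of_int b :: real) - of_int \<lfloor>of_int n / of_int b :: real\<rfloor>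
      = of_int (n mod b) / of_int b"
  proof -
    have "(of_int n :: real) = of_int (n div b) * of_int b + of_int (n mod b)"
      by (metis div_mult_mod_eq of_int_add of_int_mult)
    then show ?thesis
      unfolding floor_divide_of_int_eq using assms by (simp add: add_divide_distrib)
  qed
  ultimately show ?thesis by (simp add: sawtooth_def)
qed

text \<open>Away from the endpoints neither sawtooth argument is an integer, so the product of
  sawtooths expands. Multiplication by \<open>c\<close> permutes the residues, hence both linear
  terms have the same sum. This moves all later computations into the integers.\<close>

lemma norm_dedekind_sum_residue_sum:
  assumes b: "b > 0" and c: "gcd c b = 1"
  shows "of_int (b\<^sup>2) * norm_dedekind_sum c b = of_int (12 * residue_sum c b - 3 * b\<^sup>2 * (b - 1))"
proof -
  define r where "r k = (c * k) mod b" for k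
  have rnz: "r k \<noteq> 0" if "k \<in> {1..<b}" for k
  proof
    assume "r k = 0"
    then have "b dvd c * k" by (simp add: r_def dvd_eq_mod_eq_0)
    then have "b dvd k"
      using c by (simp add: coprime_dvd_mult_right_iff coprime_iff_gcd_eq_1 gcd.commute)
    then show False using that zdvd_imp_le by fastforce
  qed
  have split0: "{0..<b} = insert 0 {1..<b}" and splitb: "{1..b} = insert b {1..<b}"
    using b by auto
  \<comment> \<open>The term \<open>k = b\<close> is zero and drops out; the factor 4 clears the two
    halves in the sawtooths.\<close>
  have "4 * (of_int (b\<^sup>2) * dedekind_sum c b) =
      (\<Sum>k\<in>{1..<b}. 4 * (of_int (b\<^sup>2) *
        (sawtooth (of_int k / of_int b) * sawtooth (of_int (c * k) / of_int b))))"
    using b unfolding dedekind_sum_def splitb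
    by (simp add: sawtooth_of_int_div sum_distrib_left del: of_int_mult)
  also have "\<dots> = (\<Sum>k\<in>{1..<b}. of_int (4 * (k * r k) - 2 * b * k - 2 * b * r k + b\<^sup>2))"
  proof (rule sum.cong[OF refl])
    fix k assume k: "k \<in> {1..<b}"
    then have "k mod b = k" by simp
    with rnz[OF k] k show "4 * (of_int (b\<^sup>2) *
        (sawtooth (of_int k / of_int b) * sawtooth (of_int (c * k) / of_int b)))
        = of_int (4 * (k * r k) - 2 * b * k - 2 * b * r k + b\<^sup>2)"
      using b unfolding sawtooth_of_int_div[OF b]
      by (simp add: r_def field_simps power2_eq_square del: of_int_mult)
        (simp add: algebra_simps)
  qed
  also have "\<dots> = of_int (\<Sum>k\<in>{1..<b}. 4 * (k * r k) - 2 * b * k - 2 * b * r k + b\<^sup>2)"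
    by simp
  also have "(\<Sum>k\<in>{1..<b}. 4 * (k * r k) - 2 * b * k - 2 * b * r k + b\<^sup>2)
      = 4 * (\<Sum>k\<in>{1..<b}. k * r k) - 2 * b * (\<Sum>k\<in>{1..<b}. k)
        - 2 * b * (\<Sum>k\<in>{1..<b}. r k) + (b - 1) * b\<^sup>2"
    using b by (simp add: sum.distrib sum_subtractf sum_distrib_left)
  also have "(\<Sum>k\<in>{1..<b}. k * r k) = residue_sum c b"
    by (simp add: residue_sum_def r_def split0)
  also have "(\<Sum>k\<in>{1..<b}. r k) = (\<Sum>k\<in>{0..<b}. r k)"
    by (simp add: split0 r_def)
  also have "\<dots> = (\<Sum>k\<in>{0..<b}. k)"
    using sum_mult_mod[OF b c, of "\<lambda>x. x"] by (simp add: r_def)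
  also have "(\<Sum>k\<in>{1..<b}. k) = (\<Sum>k\<in>{0..<b}. k)"
    by (simp add: split0)
  finally have *: "4 * (of_int (b\<^sup>2) * dedekind_sum c b) =
    of_int (4 * residue_sum c b - b * (2 * (\<Sum>k\<in>{0..<b}. k))
      - b * (2 * (\<Sum>k\<in>{0..<b}. k)) + (b - 1) * b\<^sup>2)"
    by (simp only: mult_ac)
  have "4 * (of_int (b\<^sup>2) * dedekind_sum c b) =
    of_int (4 * residue_sum c b - b\<^sup>2 * (b - 1))"
    unfolding * sum_int_lessThan[OF less_imp_le[OF b]] by (simp add: algebra_simps power2_eq_square)
  then show ?thesis
    by (simp add: norm_dedekind_sum_def algebra_simps)
qed

text \<open>Summing the squares of the residues of \<open>c * k\<close> in two ways determines
  \<open>12 * c * K\<close> modulo \<open>b\<close>. The congruence is \<open>N\<close> \<equiv>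
  \<open>c\<close> + \<open>c\<close>* with the inverse cleared by a factor
  \<open>c\<close>.\<close>

lemma norm_dedekind_sum_cong:
  assumes b: "b > 0" and c: "gcd c b = 1"
  obtains N :: int where "of_int N = of_int b * norm_dedekind_sum c b" "[c * N = c\<^sup>2 + 1] (mod b)"
proof -
  define f where "f k = (c * k) div b" for k
  define K where "K = (\<Sum>k\<in>{0..<b}. k * f k)"
  define F where "F = (\<Sum>k\<in>{0..<b}. (f k)\<^sup>2)"
  define Q where "Q = (\<Sum>k\<in>{0..<b}. k\<^sup>2)"
  \<comment> \<open>This is \<open>(12 * residue_sum c b - 3 * b\<^sup>2 * (b - 1)) / b\<close>,
    after inserting the closed form of \<open>6 * Q\<close>.\<close>
  define N where "N = 2 * c * ((b - 1) * (2 * b - 1)) - 12 * K - 3 * b * (b - 1)"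
  have Q: "6 * Q = b * ((b - 1) * (2 * b - 1))"
    using sum_int_squares_lessThan[of b] b by (simp add: Q_def algebra_simps)
  have m: "(c * k) mod b = c * k - b * f k" for k
    by (simp add: f_def minus_mult_div_eq_mod)
  have P: "residue_sum c b = c * Q - b * K"
    unfolding residue_sum_def m Q_def K_def
    by (simp add: sum_subtractf sum_distrib_left algebra_simps power2_eq_square)
  have "Q = (\<Sum>k\<in>{0..<b}. (c * k - b * f k)\<^sup>2)"
    using sum_mult_mod[OF b c, of "\<lambda>x. x\<^sup>2"] by (simp add: m Q_def)
  also have "\<dots> = c\<^sup>2 * Q - 2 * b * c * K + b\<^sup>2 * F"
    unfolding Q_def K_def F_def
    by (simp add: sum_subtractf sum.distrib sum_distrib_left algebra_simps power2_eq_square)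
  finally have QQ: "Q = c\<^sup>2 * Q - 2 * b * c * K + b\<^sup>2 * F" .
  have "b * (12 * c * K) = (c\<^sup>2 - 1) * (6 * Q) + 6 * b\<^sup>2 * F"
    using QQ by (simp add: algebra_simps)
  also have "\<dots> = b * ((c\<^sup>2 - 1) * ((b - 1) * (2 * b - 1)) + 6 * b * F)"
    unfolding Q by (simp add: algebra_simps power2_eq_square)
  finally have K: "12 * c * K = (c\<^sup>2 - 1) * ((b - 1) * (2 * b - 1)) + 6 * b * F"
    using b by simp
  have "c * N = 2 * c\<^sup>2 * ((b - 1) * (2 * b - 1)) - 12 * c * K - 3 * c * b * (b - 1)"
    by (simp add: N_def algebra_simps power2_eq_square)
  \<comment> \<open>Modulo \<open>b\<close> the product \<open>(b - 1) * (2 * b - 1)\<close> is 1,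
    which leaves \<open>2 * c\<^sup>2 - (c\<^sup>2 - 1)\<close>.\<close>
  also have "\<dots> = c\<^sup>2 + 1 + b * ((c\<^sup>2 + 1) * (2 * b - 3) - 6 * F - 3 * c * (b - 1))"
    unfolding K by (simp add: algebra_simps power2_eq_square)
  finally have "[c * N = c\<^sup>2 + 1] (mod b)" by (simp add: cong_def)
  moreover have "12 * residue_sum c b - 3 * b\<^sup>2 * (b - 1) = b * N"
  proof -
    have "12 * residue_sum c b = 2 * c * (6 * Q) - 12 * b * K" by (simp add: P)
    then show ?thesis unfolding Q N_def by (simp add: algebra_simps power2_eq_square)
  qed
  then have "of_int (b\<^sup>2) * norm_dedekind_sum c b = of_int (b * N)"
    using norm_dedekind_sum_residue_sum[OF b c] by simp
  then have "of_int N = of_int b * norm_dedekind_sum c b" using b by (simp add: power2_eq_square)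
  ultimately show thesis using that by blast
qed

text \<open>Multiplication by \<open>d\<close> applied twice is negation modulo \<open>b\<close>.
  Reindexing by \<open>r\<close> therefore turns the residue sum into \<open>b\<close> times the sum
  of residues minus itself, which fixes its value.\<close>

lemma norm_dedekind_sum_eq_0:
  assumes b: "b > 0" and d: "gcd d b = 1" and "b dvd 1 + d\<^sup>2"
  shows "norm_dedekind_sum d b = 0"
proof -
  define r where "r k = (d * k) mod b" for k
  have split0: "{0..<b} = insert 0 {1..<b}" using b by auto
  have r0: "r 0 = 0" by (simp add: r_def)
  \<comment> \<open>Zero is excluded, since \<open>r (r 0)\<close> is 0 and not
    \<open>b\<close>.\<close>
  have rr: "r (r k) = b - k" if "k \<in> {1..<b}" for k
  proof -
    have "[d * (d * k mod b) = d * (d * k)] (mod b)" by (intro cong_scalar_left) simp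
    also have "[d * (d * k) = (b - k)] (mod b)"
    proof -
      have "d * (d * k) - (b - k) = k * (1 + d\<^sup>2) - b"
        by (simp add: algebra_simps power2_eq_square)
      then show ?thesis using assms(3) unfolding cong_iff_dvd_diff by (simp only: dvd_diff dvd_mult dvd_refl)
    qed
    finally have "r (r k) = (b - k) mod b" unfolding r_def cong_def .
    also have "\<dots> = b - k" using that by (intro mod_pos_pos_trivial) auto
    finally show ?thesis .
  qed
  have "residue_sum d b = (\<Sum>k\<in>{0..<b}. r k * r (r k))"
    using sum_mult_mod[OF b d, of "\<lambda>x. x * r x"] by (simp add: residue_sum_def r_def)
  also have "\<dots> = (\<Sum>k\<in>{1..<b}. r k * r (r k))" by (simp add: split0 r0)
  also have "\<dots> = (\<Sum>k\<in>{1..<b}. b * r k - k * r k)"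
    by (intro sum.cong) (auto simp: rr algebra_simps)
  also have "\<dots> = (\<Sum>k\<in>{0..<b}. b * r k - k * r k)" by (simp add: split0 r0)
  also have "\<dots> = b * (\<Sum>k\<in>{0..<b}. r k) - residue_sum d b"
    by (simp add: sum_subtractf sum_distrib_left residue_sum_def r_def)
  also have "(\<Sum>k\<in>{0..<b}. r k) = (\<Sum>k\<in>{0..<b}. k)"
    using sum_mult_mod[OF b d, of "\<lambda>x. x"] by (simp add: r_def)
  finally have "4 * residue_sum d b = b * (2 * (\<Sum>k\<in>{0..<b}. k))" by simp
  then have "4 * residue_sum d b = b\<^sup>2 * (b - 1)"
    using b by (simp only: sum_int_lessThan) (simp add: power2_eq_square)
  then have "12 * residue_sum d b - 3 * b\<^sup>2 * (b - 1) = 0" by simp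
  then have "of_int (b\<^sup>2) * norm_dedekind_sum d b = 0"
    unfolding norm_dedekind_sum_residue_sum[OF b d] by (simp only: of_int_0)
  then show ?thesis using b by simp
qed

section \<open>The three-term relation\<close>

lemma sum_div_shift:
  fixes t y :: int
  assumes t: "t > 0"
  shows "(\<Sum>j\<in>{0..<t}. (y + j) div t) = y"
proof -
  \<comment> \<open>This is Hermite's identity: split each \<open>y + j\<close> into quotient and
    remainder modulo \<open>t\<close>; the remainders run through all residues, so they cancel
    against the \<open>j\<close>.\<close>
  have "(\<Sum>j\<in>{0..<t}. y + j) = (\<Sum>j\<in>{0..<t}. t * ((y + j) div t) + (1 * j + y) mod t)"
    by (intro sum.cong) (auto simp: add.commute)
  also have "\<dots> = t * (\<Sum>j\<in>{0..<t}. (y + j) div t) + (\<Sum>j\<in>{0..<t}. j)"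
    using sum.reindex_bij_betw[OF bij_betw_affine_mod[OF t, of 1 y], of "\<lambda>x. x"]
    by (simp add: sum.distrib sum_distrib_left)
  finally have "t * y = t * (\<Sum>j\<in>{0..<t}. (y + j) div t)"
    using t by (simp add: sum.distrib)
  then show ?thesis using t by simp
qed

lemma sum_int_blocks:
  fixes b t :: int and g :: "int \<Rightarrow> 'a::comm_monoid_add"
  assumes b: "b > 0" and t: "t > 0"
  shows "(\<Sum>k\<in>{0..<b * t}. g k) = (\<Sum>i\<in>{0..<b}. \<Sum>j\<in>{0..<t}. g (i + b * j))"
proof -
  have "i + b * j < b * t" if "i < b" "j < t" for i j
  proof -
    have "b * (j + 1) \<le> b * t" using that b by (intro mult_left_mono) auto
    then show ?thesis using that by (simp add: algebra_simps)
  qed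
  moreover have "k div b < t" if "k < b * t" for k
    using that b by (simp add: int_div_less_iff mult.commute)
  ultimately have "(\<Sum>k\<in>{0..<b * t}. g k) = (\<Sum>(i, j)\<in>{0..<b} \<times> {0..<t}. g (i + b * j))"
    using b t
    by (intro sum.reindex_bij_witness[of _ "\<lambda>(i, j). i + b * j" "\<lambda>k. (k mod b, k div b)"])
      (auto simp: pos_imp_zdiv_nonneg_iff)
  then show ?thesis by (simp add: sum.cartesian_product)
qed

text \<open>
  With \<open>m\<close> the residue of \<open>(1 + ct)k\<close> modulo \<open>bt\<close>, the sum of \<open>km\<close> is recovered from that of
  \<open>(m - k)\<^sup>2\<close>. For \<open>k = i + bj\<close> one has \<open>m - k = rt - bt\<delta>\<close> with \<open>r\<close> the residue of
  \<open>ci\<close> modulo \<open>b\<close> and a carry \<open>\<delta> \<in> {0, 1}\<close>, so that only the sum of \<open>\<delta>\<close> over \<open>j\<close> is needed.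
\<close>
lemma residue_sum_three_term:
  fixes b c d t :: int
  assumes b: "b > 0" and t: "t > 0" and c: "gcd c b = 1" and d: "gcd d b = 1"
    and a: "gcd (1 + c * t) (b * t) = 1" and cd: "[c * d = 1 + c * t] (mod b)"
  shows "2 * residue_sum (1 + c * t) (b * t) =
    2 * (\<Sum>k\<in>{0..<b * t}. k\<^sup>2) + t ^ 3 * (\<Sum>k\<in>{0..<b}. k\<^sup>2)
    + 2 * t\<^sup>2 * (residue_sum c b - residue_sum d b) - b * t ^ 3 * (\<Sum>k\<in>{0..<b}. k)"
proof -
  define B where "B = b * t"
  define m where "m k = ((1 + c * t) * k) mod B" for k
  define r where "r i = (c * i) mod b" for i
  define e where "e i = (d * r i) mod b" for i
  define f where "f i = (r i * t + i) div b" for i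
  define \<delta> where "\<delta> i j = (f i + j) div t" for i j
  have B: "B > 0" using b t by (simp add: B_def)
  have a': "gcd (1 + c * t) B = 1" using a by (simp add: B_def)
  \<comment> \<open>The congruence \<open>cd\<close> enters here: it makes \<open>e i\<close> the
    remainder that belongs to the quotient \<open>f i\<close>.\<close>
  have bf: "b * f i = r i * t + i - e i" for i
  proof -
    have "[d * r i = d * (c * i)] (mod b)"
      unfolding r_def by (intro cong_scalar_left) simp
    also have "[d * (c * i) = (1 + c * t) * i] (mod b)"
      using cong_scalar_right[OF cd, of i] by (simp add: mult_ac)
    also have "[(1 + c * t) * i = r i * t + i] (mod b)"
    proof -
      have "[c * i = r i] (mod b)" by (simp add: r_def)
      then have "[c * i * t + i = r i * t + i] (mod b)"
        by (intro cong_add cong_scalar_right) auto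
      then show ?thesis by (simp add: algebra_simps)
    qed
    finally have "e i = (r i * t + i) mod b" by (simp add: e_def cong_def)
    then show ?thesis by (simp add: f_def minus_mod_eq_mult_div)
  qed
  have rb: "0 \<le> r i" "r i < b" for i using b by (simp_all add: r_def)
  have fb: "0 \<le> f i" "f i \<le> t" if "i \<in> {0..<b}" for i
  proof -
    show "0 \<le> f i" using that rb b t by (simp add: f_def pos_imp_zdiv_nonneg_iff)
    have "r i * t \<le> (b - 1) * t" using rb(2)[of i] t by (intro mult_right_mono) auto
    then have "r i * t + i < (t + 1) * b" using that t by (simp add: algebra_simps)
    then have "f i < t + 1" unfolding f_def int_div_less_iff[OF b] .
    then show "f i \<le> t" by simp
  qed
  \<comment> \<open>Since \<open>f i + j\<close> is at most \<open>2 * t - 1\<close>, the carry is 0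
    or 1; being idempotent, it makes the squares below linear in \<delta>.\<close>
  have \<delta>01: "(\<delta> i j)\<^sup>2 = \<delta> i j" if "i \<in> {0..<b}" "j \<in> {0..<t}" for i j
  proof -
    have "0 \<le> \<delta> i j" using fb[OF that(1)] that t by (simp add: \<delta>_def pos_imp_zdiv_nonneg_iff)
    moreover have "\<delta> i j < 2"
      using fb[OF that(1)] that t by (simp add: \<delta>_def int_div_less_iff)
    ultimately have "\<delta> i j = 0 \<or> \<delta> i j = 1" by linarith
    then show ?thesis by auto
  qed
  have mk: "m (i + b * j) - (i + b * j) = r i * t - B * \<delta> i j" for i j
  proof -
    have "[c * (i + b * j) * t = r i * t] (mod B)"
    proof -
      have "b dvd c * i - r i" by (simp add: r_def mod_eq_dvd_iff[symmetric])
      then have "b * t dvd (c * i - r i) * t" by simp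
      then have "B dvd (c * i - r i) * t + B * (c * j)" by (simp add: B_def)
      then show ?thesis by (simp add: cong_iff_dvd_diff B_def algebra_simps)
    qed
    then have "[c * (i + b * j) * t + (i + b * j) = r i * t + (i + b * j)] (mod B)"
      by (intro cong_add) auto
    then have "m (i + b * j) = (r i * t + (i + b * j)) mod B"
      by (simp add: m_def cong_def algebra_simps)
    moreover have "(r i * t + (i + b * j)) div B = \<delta> i j"
    proof -
      have "(r i * t + (i + b * j)) div B = ((r i * t + i + b * j) div b) div t"
        using b t by (simp add: B_def zdiv_zmult2_eq add.assoc)
      also have "(r i * t + i + b * j) div b = f i + j"
        using b by (simp add: f_def)
      finally show ?thesis by (simp add: \<delta>_def)
    qed
    ultimately show ?thesis using mult_div_mod_eq[of B "r i * t + (i + b * j)"] by simp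
  qed
  have inner: "(\<Sum>j\<in>{0..<t}. (m (i + b * j) - (i + b * j))\<^sup>2) =
      t\<^sup>2 * (- (t * (r i)\<^sup>2) - 2 * (i * r i) + 2 * (r i * e i) + b * (t * r i + i - e i))"
    if i: "i \<in> {0..<b}" for i
  proof -
    have "(\<Sum>j\<in>{0..<t}. (m (i + b * j) - (i + b * j))\<^sup>2) =
      (\<Sum>j\<in>{0..<t}. t\<^sup>2 * ((r i)\<^sup>2 - 2 * b * r i * \<delta> i j + b\<^sup>2 * (\<delta> i j)\<^sup>2))"
      unfolding mk B_def by (simp add: algebra_simps power2_eq_square)
    also have "\<dots> = (\<Sum>j\<in>{0..<t}. t\<^sup>2 * ((r i)\<^sup>2 - 2 * b * r i * \<delta> i j + b\<^sup>2 * \<delta> i j))"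
      by (intro sum.cong) (simp_all add: \<delta>01[OF i])
    also have "\<dots> = t\<^sup>2 * (t * (r i)\<^sup>2 - 2 * b * r i * (\<Sum>j\<in>{0..<t}. \<delta> i j)
        + b\<^sup>2 * (\<Sum>j\<in>{0..<t}. \<delta> i j))"
      using t by (simp add: sum.distrib sum_subtractf flip: sum_distrib_left)
    \<comment> \<open>By Hermite's identity the carries over one block add up to \<open>f i\<close>,
      which \<open>bf\<close> then eliminates.\<close>
    also have "\<dots> = t\<^sup>2 * (t * (r i)\<^sup>2 - 2 * r i * (b * f i) + b * (b * f i))"
      unfolding \<delta>_def sum_div_shift[OF t] by (simp add: algebra_simps power2_eq_square)
    finally show ?thesis unfolding bf by (simp add: algebra_simps power2_eq_square)
  qed
  have sr: "(\<Sum>i\<in>{0..<b}. g (r i)) = (\<Sum>i\<in>{0..<b}. g i)" for g :: "int \<Rightarrow> int"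
    using sum_mult_mod[OF b c] by (simp add: r_def)
  have se: "(\<Sum>i\<in>{0..<b}. e i) = (\<Sum>i\<in>{0..<b}. i)"
    using sr[of "\<lambda>x. (d * x) mod b"] sum_mult_mod[OF b d, of "\<lambda>x. x"] by (simp add: e_def)
  have sre: "(\<Sum>i\<in>{0..<b}. r i * e i) = residue_sum d b"
    using sr[of "\<lambda>x. x * ((d * x) mod b)"] by (simp add: e_def residue_sum_def)
  have "(\<Sum>k\<in>{0..<B}. (m k - k)\<^sup>2) =
    (\<Sum>i\<in>{0..<b}. \<Sum>j\<in>{0..<t}. (m (i + b * j) - (i + b * j))\<^sup>2)"
    unfolding B_def by (rule sum_int_blocks[OF b t])
  also have "\<dots> = (\<Sum>i\<in>{0..<b}. t\<^sup>2 * (- (t * (r i)\<^sup>2) - 2 * (i * r i)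
      + 2 * (r i * e i) + b * (t * r i + i - e i)))"
    by (intro sum.cong refl inner)
  also have "\<dots> = t\<^sup>2 * (- (t * (\<Sum>i\<in>{0..<b}. (r i)\<^sup>2)) - 2 * (\<Sum>i\<in>{0..<b}. i * r i)
      + 2 * (\<Sum>i\<in>{0..<b}. r i * e i)
      + b * (t * (\<Sum>i\<in>{0..<b}. r i) + (\<Sum>i\<in>{0..<b}. i) - (\<Sum>i\<in>{0..<b}. e i)))"
    by (simp add: sum.distrib sum_subtractf sum_negf flip: sum_distrib_left)
  also have "\<dots> = t\<^sup>2 * (- (t * (\<Sum>i\<in>{0..<b}. i\<^sup>2)) - 2 * residue_sum c b
      + 2 * residue_sum d b + b * (t * (\<Sum>i\<in>{0..<b}. i)))"
    unfolding se sre sr[of "\<lambda>x. x\<^sup>2"] sr[of "\<lambda>x. x"] by (simp add: residue_sum_def r_def)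
  finally have 1: "(\<Sum>k\<in>{0..<B}. (m k - k)\<^sup>2) = \<dots>" .
  have "(\<Sum>k\<in>{0..<B}. (m k - k)\<^sup>2) =
    (\<Sum>k\<in>{0..<B}. (m k)\<^sup>2) + (\<Sum>k\<in>{0..<B}. k\<^sup>2) - 2 * (\<Sum>k\<in>{0..<B}. k * m k)"
    by (simp add: power2_diff sum.distrib sum_subtractf sum_distrib_left mult_ac)
  also have "(\<Sum>k\<in>{0..<B}. (m k)\<^sup>2) = (\<Sum>k\<in>{0..<B}. k\<^sup>2)"
    using sum_mult_mod[OF B a', of "\<lambda>x. x\<^sup>2"] by (simp add: m_def)
  also have "(\<Sum>k\<in>{0..<B}. k * m k) = residue_sum (1 + c * t) B"
    by (simp add: residue_sum_def m_def)
  finally have "2 * residue_sum (1 + c * t) B =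
    2 * (\<Sum>k\<in>{0..<B}. k\<^sup>2) - (\<Sum>k\<in>{0..<B}. (m k - k)\<^sup>2)" by simp
  then show ?thesis unfolding 1 unfolding B_def
    by (simp add: algebra_simps power2_eq_square power3_eq_cube)
qed

text \<open>The closed forms of the power sums reduce the residue-sum identity to
  \<open>t\<^sup>2 * (12 * D)\<close> plus explicit terms; division by
  \<open>(b * t)\<^sup>2\<close> turns the first into a difference of normalized sums for
  \<open>b\<close>.\<close>

lemma norm_dedekind_sum_three_term:
  fixes b c d t :: int
  assumes b: "b > 0" and t: "t > 0" and c: "gcd c b = 1" and d: "gcd d b = 1"
    and a: "gcd (1 + c * t) (b * t) = 1" and cd: "[c * d = 1 + c * t] (mod b)"
  shows "norm_dedekind_sum (1 + c * t) (b * t) =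
    norm_dedekind_sum c b - norm_dedekind_sum d b + of_int (t\<^sup>2 + 2) / of_int (b * t) - 3"
proof -
  define P where "P = residue_sum (1 + c * t) (b * t)"
  define D where "D = residue_sum c b - residue_sum d b"
  have bt: "b * t > 0" using b t by simp
  have "12 * P = 2 * (6 * (\<Sum>k\<in>{0..<b * t}. k\<^sup>2)) + t ^ 3 * (6 * (\<Sum>k\<in>{0..<b}. k\<^sup>2))
    + 12 * t\<^sup>2 * D - 3 * b * t ^ 3 * (2 * (\<Sum>k\<in>{0..<b}. k))"
    using residue_sum_three_term[OF assms] unfolding P_def D_def by (simp add: algebra_simps)
  also have "\<dots> = 2 * ((b * t - 1) * (b * t) * (2 * (b * t) - 1))
    + t ^ 3 * ((b - 1) * b * (2 * b - 1)) + 12 * t\<^sup>2 * D - 3 * b * t ^ 3 * (b * (b - 1))"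
    using b bt by (simp only: sum_int_lessThan sum_int_squares_lessThan less_imp_le)
  finally have "12 * P - 3 * (b * t)\<^sup>2 * (b * t - 1) =
    t\<^sup>2 * (12 * D) + b * t * (t\<^sup>2 + 2) - 3 * (b * t)\<^sup>2"
    by (simp add: algebra_simps power2_eq_square power3_eq_cube)
  then have "of_int ((b * t)\<^sup>2) * norm_dedekind_sum (1 + c * t) (b * t) =
    of_int (t\<^sup>2 * (12 * D) + b * t * (t\<^sup>2 + 2) - 3 * (b * t)\<^sup>2)"
    using norm_dedekind_sum_residue_sum[OF bt a] by (simp only: P_def)
  also have "\<dots> = of_int (t\<^sup>2) * of_int (12 * D)
      + of_int (b * t * (t\<^sup>2 + 2) - 3 * (b * t)\<^sup>2)"
    by simp
  also have "of_int (12 * D) = of_int (b\<^sup>2) * (norm_dedekind_sum c b - norm_dedekind_sum d b)"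
    unfolding right_diff_distrib norm_dedekind_sum_residue_sum[OF b c]
      norm_dedekind_sum_residue_sum[OF b d]
    by (simp add: D_def)
  finally have "norm_dedekind_sum (1 + c * t) (b * t) =
    (of_int (t\<^sup>2) * (of_int (b\<^sup>2) * (norm_dedekind_sum c b - norm_dedekind_sum d b))
      + of_int (b * t * (t\<^sup>2 + 2) - 3 * (b * t)\<^sup>2)) / of_int ((b * t)\<^sup>2)"
    using b t by (simp add: eq_divide_eq mult_ac)
  also have "\<dots> = norm_dedekind_sum c b - norm_dedekind_sum d b
      + of_int (t\<^sup>2 + 2) / of_int (b * t) - 3"
    using b t by (simp add: field_simps power2_eq_square)
  finally show ?thesis .
qed

section \<open>Transfer of suitability to the larger modulus\<close>

theorem theorem2:
  fixes b c d cstar t b1 c1 d1 :: int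
  assumes "b > 0"
    and "\<not> [c = d] (mod b)"
    and "gcd c b = 1" and "gcd d b = 1"
    and "suitable b c d"
    and "[c * cstar = 1] (mod b)"
    and "t > 0"
    and "[t = d - cstar] (mod b)"
    and "b1 = b * t" and "c1 = 1 + c * t" and "d1 = 1 + d * t"
  shows "b1 > b \<and> suitable b1 c1 d1"
proof -
  note b = assms(1) and ncd = assms(2) and c = assms(3) and d = assms(4) and t = assms(7)
  have S: "norm_dedekind_sum c b = norm_dedekind_sum d b" "norm_dedekind_sum d b \<noteq> 0"
    using assms(5) by (auto simp: suitable_def)
  have b1: "b \<noteq> 1" using ncd by auto
  obtain N where N: "of_int N = of_int b * norm_dedekind_sum c b" "[c * N = c\<^sup>2 + 1] (mod b)"
    using norm_dedekind_sum_cong[OF b c] by blast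
  obtain N' where N': "of_int N' = of_int b * norm_dedekind_sum d b" "[d * N' = d\<^sup>2 + 1] (mod b)"
    using norm_dedekind_sum_cong[OF b d] by blast
  have "N' = N" using N(1) N'(1) S(1) by (metis of_int_eq_iff)
  then have dN: "b dvd d * N - (d\<^sup>2 + 1)" using N'(2) by (simp add: cong_iff_dvd_diff)
  have cN: "b dvd c * N - (c\<^sup>2 + 1)" using N(2) by (simp add: cong_iff_dvd_diff)
  have cd: "b dvd c * d - (1 + c * t)"
  proof -
    have "b dvd c * cstar - 1" "b dvd t - (d - cstar)"
      using assms(6,8) unfolding cong_iff_dvd_diff by blast+
    then have "b dvd 1 * (c * cstar - 1) + (- c) * (t - (d - cstar)) + 0"
      by (meson dvd_add dvd_mult dvd_0_right)
    then show ?thesis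
      by (rule back_subst[of "\<lambda>x. b dvd x"]) (simp add: algebra_simps)
  qed
  txt \<open>The symmetric congruence, where \<open>c + c\<^sup>* \<equiv> d + d\<^sup>* (mod b)\<close> enters.\<close>
  have dc: "b dvd d * c - (1 + d * t)"
  proof -
    \<comment> \<open>The terms with \<open>N\<close> cancel in this combination, leaving a multiple
      of the unit \<open>c\<close>.\<close>
    have "b dvd d * (c * d - (1 + c * t)) + d * (c * N - (c\<^sup>2 + 1)) * (-1)
        + c * (d * N - (d\<^sup>2 + 1))"
      by (intro dvd_add dvd_mult dvd_mult2 cd dN cN)
    then have "b dvd c * (d * c - (1 + d * t))"
      by (rule back_subst[of "\<lambda>x. b dvd x"]) (simp add: algebra_simps power2_eq_square)
    then show ?thesis
      using c by (simp add: coprime_dvd_mult_right_iff coprime_iff_gcd_eq_1 gcd.commute)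
  qed
  \<comment> \<open>Modulo \<open>b\<close> the number \<open>1 + x * t\<close> is the product of
    two units, and modulo \<open>t\<close> it is 1.\<close>
  have cop: "gcd (1 + x * t) (b * t) = 1"
    if "b dvd x * y - (1 + x * t)" "gcd x b = 1" "gcd y b = 1" for x y
  proof -
    have "coprime (x * y) b" using that(2,3) by (simp flip: coprime_iff_gcd_eq_1)
    moreover have "[x * y = 1 + x * t] (mod b)" using that(1) by (simp add: cong_iff_dvd_diff)
    ultimately have "coprime (1 + x * t) b"
      using cong_imp_coprime by blast
    moreover have "coprime (1 + x * t) t"
      by (metis coprime_1_left coprime_iff_gcd_eq_1 gcd.commute gcd_add_mult add.commute)
    ultimately show ?thesis by (simp add: coprime_iff_gcd_eq_1[symmetric])
  qed
  have gc: "gcd (1 + c * t) (b * t) = 1" and gd: "gcd (1 + d * t) (b * t) = 1"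
    using cop[OF cd c d] cop[OF dc d c] by simp_all
  have Sc: "norm_dedekind_sum (1 + c * t) (b * t) = of_int (t\<^sup>2 + 2) / of_int (b * t) - 3"
    using norm_dedekind_sum_three_term[OF b t c d gc] cd S(1) by (simp add: cong_iff_dvd_diff)
  have Sd: "norm_dedekind_sum (1 + d * t) (b * t) = of_int (t\<^sup>2 + 2) / of_int (b * t) - 3"
    using norm_dedekind_sum_three_term[OF b t d c gd] dc S(1) by (simp add: cong_iff_dvd_diff)
  \<comment> \<open>The two symmetric congruences differ by \<open>(c - d) * t\<close>, so
    \<open>t = 1\<close> would force \<open>c\<close> \<equiv> \<open>d\<close>.\<close>
  have "t \<noteq> 1"
  proof
    assume "t = 1"
    have "b dvd (d * c - (1 + d * t)) - (c * d - (1 + c * t))" by (rule dvd_diff[OF dc cd])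
    then show False using ncd \<open>t = 1\<close> by (simp add: cong_iff_dvd_diff algebra_simps)
  qed
  then have t2: "t \<ge> 2" using t by simp
  then have "b * 1 < b * t" using b by (intro mult_strict_left_mono) auto
  then have bb: "b * t > b" by simp
  \<comment> \<open>A zero would make \<open>t\<close> a divisor of 2, hence \<open>t = 2\<close>,
    and then \<open>b = 1\<close>.\<close>
  have "norm_dedekind_sum (1 + d * t) (b * t) \<noteq> 0"
  proof
    assume "norm_dedekind_sum (1 + d * t) (b * t) = 0"
    then have "real_of_int (t\<^sup>2 + 2) = of_int (3 * (b * t))"
      using b t unfolding Sd by (simp add: field_simps)
    then have eq: "t\<^sup>2 + 2 = 3 * (b * t)" by (simp only: of_int_eq_iff)
    then have "2 = t * (3 * b - t)" by (simp add: algebra_simps power2_eq_square)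
    then have "t dvd 2" by (rule dvdI)
    then have "t = 2" using t2 zdvd_imp_le by fastforce
    then show False using eq b1 by simp
  qed
  moreover have "\<not> [1 + c * t = 1 + d * t] (mod b * t)"
  proof
    assume "[1 + c * t = 1 + d * t] (mod b * t)"
    then have "b * t dvd (c - d) * t" by (simp add: cong_iff_dvd_diff algebra_simps)
    then have "b dvd c - d" using t by simp
    then show False using ncd by (simp add: cong_iff_dvd_diff)
  qed
  moreover have "\<not> [(1 + c * t) * (1 + d * t) = 1] (mod b * t)"
  proof
    assume "[(1 + c * t) * (1 + d * t) = 1] (mod b * t)"
    then have "b * t dvd (c + d + c * d * t) * t" by (simp add: cong_iff_dvd_diff algebra_simps)
    then have "b dvd c + d + c * d * t" using t by simp
    \<comment> \<open>The added multiple of \<open>cd\<close> eliminates \<open>t\<close> and leaves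
      \<open>c * (1 + d\<^sup>2)\<close>.\<close>
    then have "b dvd (c + d + c * d * t) + d * (c * d - (1 + c * t))"
      by (rule dvd_add[OF _ dvd_mult[OF cd]])
    then have "b dvd c * (1 + d\<^sup>2)"
      by (rule back_subst[of "\<lambda>x. b dvd x"]) (simp add: algebra_simps power2_eq_square)
    then have "b dvd 1 + d\<^sup>2"
      using c by (simp add: coprime_dvd_mult_right_iff coprime_iff_gcd_eq_1 gcd.commute)
    then show False using norm_dedekind_sum_eq_0[OF b d] S(2) by simp
  qed
  then have "\<forall>x. [(1 + c * t) * x = 1] (mod b * t) \<longrightarrow> \<not> [1 + d * t = x] (mod b * t)"
    by (meson cong_scalar_left cong_trans)
  ultimately have "suitable (b * t) (1 + c * t) (1 + d * t)"
    unfolding suitable_def using b t gc gd Sc Sd by simp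
  with bb show ?thesis by (simp add: assms(9-11))
qed

end
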